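(* Let $G_1, G_2$ be (not necessarily connected) bipartite graphs on $k$ vertices, and let $H = K_{m,n}$ ($m,n\ge 1$) be a complete bipartite graph. Then $X_{G_1}^H = X_{G_2}^H$ (i.e. $G_1$ is $H$-chromatically equivalent to $G_2$) if and only if $S(G_1) = S(G_2)$ as multisets.
   Context: All graphs are finite, simple, undirected, with at least one vertex. $H$-chromatic symmetric function: let $G,H$ be graphs with $|V(G)|=k$, $|V(H)|=n$. A labeling of $H$ is a bijection $\phi:V(H)\to[n]$. A proper $(H,\phi)$-coloring of $G$ is a map $\kappa:V(G)\to[n]$ such that whenever $u,v$ are adjacent in $G$, $\phi^{-1}(\kappa(u))$ and $\phi^{-1}(\kappa(v))$ are adjacent in $H$. Put $w_G^H=\sum_\phi\sum_\kappa\prod_{v\in V(G)}x_{\kappa(v)}$, summed over all labelings $\phi$ and all proper $(H,\phi)$-colorings $\kappa$. This is a symmetric polynomial in $x_1,\dots,x_n$, homogeneous of degree $k$; writing $w_G^H=\sum_{\lambda\vdash k,\,l(\lambda)\le n}c_\lambda m_\lambda(x_1,\dots,x_n)$ (with $m_\lambda$ the monomial symmetric functions and $l(\lambda)$ the number of parts), define $X_G^H=\sum_{\lambda\vdash k,\,l(\lambda)\le n}c_\lambda m_\lambda\in\Lambda^k$. For a bipartite graph $G$ with connected components $G_1,\dots,G_l$, let $V_1^i,V_2^i$ be the two parts of the (unique) bipartition of $G_i$ (one part being empty if $G_i$ is a single vertex), and $g_j^i=|V_j^i|$. Then $S(G)$ is the multiset $S(G)=\{\{\sum_{i=1}^l g_{p_i}^i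 \mid p=(p_1,\dots,p_l)\in\{1,2\}^l\}\}$, having $2^l$ elements counted with multiplicity. *)

theory Defs
  imports
    "HOL-Library.Poly_Mapping"
    "HOL-Library.Multiset"
    "HOL-Combinatorics.Permutations"
    "Graph_Theory.Graph_Theory"
begin

section \<open>Symmetric polynomials and symmetric functions\<close>

text \<open>
  An exponent vector is a finitely supported map \<open>nat \<Rightarrow>\<^sub>0 nat\<close>, a polynomial is a finitely supported
  family of coefficients over exponent vectors, and a formal power series in
  \<open>x\<^sub>1, x\<^sub>2, \<dots>\<close> is an arbitrary family of coefficients over exponent vectors; the ring
  of symmetric functions is regarded as a set of such series. Index \<open>0\<close> is never used
  as a variable. Integer partitions are multisets of positive numbers.
\<close>

type_synonym exponents = "nat \<Rightarrow>\<^sub>0 nat"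

type_synonym polynomial = "exponents \<Rightarrow>\<^sub>0 int"

type_synonym power_series = "exponents \<Rightarrow> int"

abbreviation (input) lookup :: "('i \<Rightarrow>\<^sub>0 'z::zero) \<Rightarrow> 'i \<Rightarrow> 'z"
  where "lookup \<equiv> Poly_Mapping.lookup"

abbreviation (input) keys :: "('i \<Rightarrow>\<^sub>0 'z::zero) \<Rightarrow> 'i set"
  where "keys \<equiv> Poly_Mapping.keys"

definition var :: "nat \<Rightarrow> polynomial"
  where "var i = Poly_Mapping.single (Poly_Mapping.single i 1) 1"

definition exponent_type :: "exponents \<Rightarrow> nat multiset"
  where "exponent_type \<alpha> = image_mset (lookup \<alpha>) (mset_set (keys \<alpha>))"

definition monomial_symmetric :: "nat set \<Rightarrow> nat multiset \<Rightarrow> power_series"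
  where "monomial_symmetric I \<mu> \<alpha> = (if keys \<alpha> \<subseteq> I \<and> exponent_type \<alpha> = \<mu> then 1 else 0)"

text \<open>The variable set \<open>I\<close> is \<open>{1..n}\<close> for \<open>m\<^sub>\<mu>(x\<^sub>1, \<dots>, x\<^sub>n)\<close> and \<open>{1..}\<close> for \<open>m\<^sub>\<mu> \<in> \<Lambda>\<close>.\<close>

definition partitions :: "nat \<Rightarrow> nat \<Rightarrow> nat multiset set"
  where "partitions k n = {\<mu>. 0 \<notin># \<mu> \<and> sum_mset \<mu> = k \<and> size \<mu> \<le> n}"


section \<open>\<open>H\<close>-chromatic symmetric functions\<close>

text \<open>
  Simple undirected graphs are the symmetric loop-free digraphs of the locale \<open>graph\<close>, so
  \<open>u \<rightarrow>\<^bsub>G\<^esub> v\<close> is adjacency and the strongly connected components \<open>pre_digraph.sccs G\<close> are the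
  connected components (as induced subgraphs). Labelings and colorings are extensional
  functions, so that each one is counted once.
\<close>

definition labelings :: "('c, 'd) pre_digraph \<Rightarrow> ('c \<Rightarrow> nat) set"
  where "labelings H =
    {\<phi> \<in> verts H \<rightarrow>\<^sub>E {1..card (verts H)}. bij_betw \<phi> (verts H) {1..card (verts H)}}"

definition proper_colorings ::
    "('a, 'b) pre_digraph \<Rightarrow> ('c, 'd) pre_digraph \<Rightarrow> ('c \<Rightarrow> nat) \<Rightarrow> ('a \<Rightarrow> nat) set"
  where "proper_colorings G H \<phi> =
    {\<kappa> \<in> verts G \<rightarrow>\<^sub>E {1..card (verts H)}. \<forall>u \<in> verts G. \<forall>v \<in> verts G. u \<rightarrow>\<^bsub>G\<^esub> v \<longrightarrow>
        inv_into (verts H) \<phi> (\<kappa> u) \<rightarrow>\<^bsub>H\<^esub> inv_into (verts H) \<phi> (\<kappa> v)}"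

definition chromatic_polynomial :: "('a, 'b) pre_digraph \<Rightarrow> ('c, 'd) pre_digraph \<Rightarrow> polynomial"
  where "chromatic_polynomial G H =
    (\<Sum>\<phi> \<in> labelings H. \<Sum>\<kappa> \<in> proper_colorings G H \<phi>. \<Prod>v \<in> verts G. var (\<kappa> v))"

definition monomial_expansion :: "polynomial \<Rightarrow> nat \<Rightarrow> nat \<Rightarrow> (nat multiset \<Rightarrow> int) \<Rightarrow> bool"
  where "monomial_expansion w k n c \<longleftrightarrow>
    (\<forall>\<mu>. \<mu> \<notin> partitions k n \<longrightarrow> c \<mu> = 0) \<and>
    lookup w = (\<lambda>\<alpha>. \<Sum>\<mu> \<in> partitions k n. c \<mu> * monomial_symmetric {1..n} \<mu> \<alpha>)"

definition chromatic_coeff ::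
    "('a, 'b) pre_digraph \<Rightarrow> ('c, 'd) pre_digraph \<Rightarrow> nat multiset \<Rightarrow> int"
  where "chromatic_coeff G H =
    (THE c. monomial_expansion (chromatic_polynomial G H) (card (verts G)) (card (verts H)) c)"

definition chromatic_symmetric_function ::
    "('a, 'b) pre_digraph \<Rightarrow> ('c, 'd) pre_digraph \<Rightarrow> power_series"
  where "chromatic_symmetric_function G H =
    (\<lambda>\<alpha>. \<Sum>\<mu> \<in> partitions (card (verts G)) (card (verts H)).
        chromatic_coeff G H \<mu> * monomial_symmetric {1..} \<mu> \<alpha>)"


section \<open>Bipartite graphs and the multiset \<open>S(G)\<close>\<close>

definition bipartition :: "('a, 'b) pre_digraph \<Rightarrow> 'a set \<Rightarrow> 'a set \<Rightarrow> bool"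
  where "bipartition G V1 V2 \<longleftrightarrow>
    verts G = V1 \<union> V2 \<and> V1 \<inter> V2 = {} \<and> arcs_ends G \<subseteq> V1 \<times> V2 \<union> V2 \<times> V1"

definition bipartite :: "('a, 'b) pre_digraph \<Rightarrow> bool"
  where "bipartite G \<longleftrightarrow> (\<exists>V1 V2. bipartition G V1 V2)"

text \<open>
  The bipartition of a connected graph is unique only up to the order of its parts, which is
  chosen arbitrarily here; \<open>S(G)\<close> does not depend on it (lemma \<open>part_size_multiset_eq\<close>).
\<close>

definition part :: "('a, 'b) pre_digraph \<Rightarrow> nat \<Rightarrow> 'a set"
  where "part C = (SOME V. bipartition C (V 1) (V 2))"

definition part_size_multiset :: "('a, 'b) pre_digraph \<Rightarrow> nat multiset"
  where "part_size_multiset G =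
    {# \<Sum>C \<in> pre_digraph.sccs G. card (part C (p C)).
       p \<in># mset_set (pre_digraph.sccs G \<rightarrow>\<^sub>E {1, 2}) #}"


section \<open>Well-definedness\<close>

lemma exponent_type_in_partitions:
  assumes "keys \<alpha> \<subseteq> {1..n}"
  shows "exponent_type \<alpha> \<in> partitions (\<Sum>i \<in> keys \<alpha>. lookup \<alpha> i) n"
proof -
  have "card (keys \<alpha>) \<le> n"
    using card_mono[OF _ assms] by simp
  then show ?thesis
    by (auto simp: partitions_def exponent_type_def sum_unfold_sum_mset in_keys_iff)
qed

lemma ex_exponents_of_type:
  assumes "\<mu> \<in> partitions k n"
  shows "\<exists>\<alpha>. keys \<alpha> \<subseteq> {1..n} \<and> exponent_type \<alpha> = \<mu>"
proof -
  obtain xs where xs: "mset xs = \<mu>"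
    using ex_mset by blast
  have len: "length xs \<le> n" and pos: "0 \<notin> set xs"
    using assms xs by (auto simp: partitions_def)
  define f where "f i = (if i \<in> {1..length xs} then xs ! (i - 1) else 0)" for i
  have fin: "finite {i. f i \<noteq> 0}"
    by (rule finite_subset[of _ "{1..length xs}"]) (auto simp: f_def split: if_splits)
  define \<alpha> where "\<alpha> = Abs_poly_mapping f"
  have lk: "lookup \<alpha> = f"
    using fin by (simp add: \<alpha>_def)
  have nz: "f i \<noteq> 0" if "i \<in> {1..length xs}" for i
  proof -
    have "xs ! (i - 1) \<in> set xs"
      using that by (intro nth_mem) auto
    then show ?thesis
      using that pos by (metis f_def)
  qed
  have ks: "keys \<alpha> = {1..length xs}"
    using nz by (auto simp: in_keys_iff lk) (auto simp: f_def split: if_splits)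
  have "exponent_type \<alpha> = image_mset f (mset_set {1..length xs})"
    by (simp add: exponent_type_def lk ks)
  also have "mset_set {1..length xs} = image_mset Suc (mset_set {..<length xs})"
    by (simp add: image_mset_mset_set image_Suc_lessThan)
  also have "image_mset f (image_mset Suc (mset_set {..<length xs}))
      = image_mset ((!) xs) (mset_set {..<length xs})"
    unfolding image_mset.compositionality by (rule image_mset_cong) (auto simp: f_def)
  also have "\<dots> = mset xs"
    by (metis map_nth mset_map mset_upt atLeast0LessThan)
  finally have "exponent_type \<alpha> = \<mu>"
    using xs by simp
  moreover have "keys \<alpha> \<subseteq> {1..n}"
    using ks len by simp
  ultimately show ?thesis
    by blast
qed

lemma finite_partitions: "finite (partitions k n)"
proof (rule finite_surj)
  show "finite {xs. set xs \<subseteq> {..k} \<and> length xs \<le> n}"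
    by (rule finite_lists_length_le) simp
  show "partitions k n \<subseteq> mset ` {xs. set xs \<subseteq> {..k} \<and> length xs \<le> n}"
  proof
    fix l assume l: "l \<in> partitions k n"
    obtain xs where xs: "mset xs = l"
      using ex_mset by blast
    have "set xs \<subseteq> {..k}"
    proof
      fix x assume "x \<in> set xs"
      then have "x \<le> sum_list xs"
        by (rule member_le_sum_list) simp
      then show "x \<in> {..k}"
        using l xs by (auto simp: partitions_def sum_mset_sum_list)
    qed
    then show "l \<in> mset ` {xs. set xs \<subseteq> {..k} \<and> length xs \<le> n}"
      using l xs by (auto simp: partitions_def)
  qed
qed

lemma sum_monomial_symmetric:
  assumes "keys \<alpha> \<subseteq> {1..n}" "exponent_type \<alpha> \<in> partitions k n"
  shows "(\<Sum>\<mu> \<in> partitions k n. c \<mu> * monomial_symmetric {1..n} \<mu> \<alpha>) = c (exponent_type \<alpha>)"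
proof -
  have "(\<Sum>\<mu> \<in> partitions k n. c \<mu> * monomial_symmetric {1..n} \<mu> \<alpha>)
      = (\<Sum>\<mu> \<in> partitions k n. if \<mu> = exponent_type \<alpha> then c \<mu> else 0)"
    using assms by (intro sum.cong) (auto simp: monomial_symmetric_def)
  also have "\<dots> = c (exponent_type \<alpha>)"
    using assms(2) finite_partitions by simp
  finally show ?thesis .
qed

lemma prod_var:
  "(\<Prod>v \<in> A. var (\<kappa> v)) = Poly_Mapping.single (\<Sum>v \<in> A. Poly_Mapping.single (\<kappa> v) 1) 1"
  by (induction A rule: infinite_finite_induct) (auto simp: var_def mult_single)

lemma lookup_sum_single:
  assumes "finite A"
  shows "lookup (\<Sum>v \<in> A. Poly_Mapping.single (\<kappa> v) (1::nat)) i = card {v \<in> A. \<kappa> v = i}"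
proof -
  have "lookup (\<Sum>v \<in> A. Poly_Mapping.single (\<kappa> v) (1::nat)) i = (\<Sum>v \<in> A. if \<kappa> v = i then 1 else 0)"
    unfolding One_nat_def by (simp add: lookup_sum lookup_single when_def)
  also have "\<dots> = card {v \<in> A. \<kappa> v = i}"
    using assms by (simp add: sum.If_cases Int_def)
  finally show ?thesis .
qed

lemma lookup_chromatic_polynomial:
  assumes "finite (verts G)"
  shows "lookup (chromatic_polynomial G H) \<alpha> = (\<Sum>\<phi> \<in> labelings H. \<Sum>\<kappa> \<in> proper_colorings G H \<phi>.
    if \<forall>i. lookup \<alpha> i = card {v \<in> verts G. \<kappa> v = i} then 1 else 0)"
proof -
  have "(\<alpha> = (\<Sum>v \<in> verts G. Poly_Mapping.single (\<kappa> v) (1::nat)))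
      = (\<forall>i. lookup \<alpha> i = card {v \<in> verts G. \<kappa> v = i})" for \<kappa>
    using lookup_sum_single[OF assms, of \<kappa>] by (metis poly_mapping_eqI)
  then show ?thesis
    by (simp add: chromatic_polynomial_def prod_var lookup_sum lookup_single when_def)
qed

lemma permuted_labelings:
  assumes "\<sigma> permutes {1..card (verts H)}" "\<phi> \<in> labelings H"
  shows "restrict (\<sigma> \<circ> \<phi>) (verts H) \<in> labelings H"
proof -
  have "bij_betw (\<sigma> \<circ> \<phi>) (verts H) {1..card (verts H)}"
    using assms by (auto simp: labelings_def intro: bij_betw_trans dest: permutes_imp_bij)
  then have "bij_betw (restrict (\<sigma> \<circ> \<phi>) (verts H)) (verts H) {1..card (verts H)}"
    by (simp cong: bij_betw_cong)
  then show ?thesis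
    by (auto simp: labelings_def dest: bij_betwE)
qed

lemma permuted_colorings:
  assumes "\<sigma> permutes {1..card (verts H)}" "\<phi> \<in> labelings H" "\<kappa> \<in> proper_colorings G H \<phi>"
  shows "restrict (\<sigma> \<circ> \<kappa>) (verts G) \<in> proper_colorings G H (restrict (\<sigma> \<circ> \<phi>) (verts H))"
proof -
  let ?\<phi> = "restrict (\<sigma> \<circ> \<phi>) (verts H)"
  have bij: "bij_betw \<phi> (verts H) {1..card (verts H)}"
    using assms(2) by (simp add: labelings_def)
  have bij': "inj_on ?\<phi> (verts H)"
    using permuted_labelings[OF assms(1,2)] by (auto simp: labelings_def bij_betw_def)
  have inv: "inv_into (verts H) ?\<phi> (\<sigma> i) = inv_into (verts H) \<phi> i" if i: "i \<in> {1..card (verts H)}" for i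
  proof -
    have "inv_into (verts H) \<phi> i \<in> verts H" "\<phi> (inv_into (verts H) \<phi> i) = i"
      using bij i by (auto simp: bij_betw_def inv_into_into f_inv_into_f)
    then show ?thesis
      using inv_into_f_f[OF bij', of "inv_into (verts H) \<phi> i"] by simp
  qed
  have \<kappa>: "\<kappa> v \<in> {1..card (verts H)}" if "v \<in> verts G" for v
    using assms(3) that by (auto simp: proper_colorings_def)
  have "\<sigma> (\<kappa> v) \<in> {1..card (verts H)}" if "v \<in> verts G" for v
    using \<kappa>[OF that] assms(1) by (metis permutes_in_image)
  then show ?thesis
    using assms(3) \<kappa> inv by (auto simp: proper_colorings_def)
qed

lemma lookup_chromatic_polynomial_permute:
  assumes fin: "finite (verts G)"
    and \<sigma>: "\<sigma> permutes {1..card (verts H)}" and \<beta>: "\<And>i. lookup \<alpha> i = lookup \<beta> (\<sigma> i)"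
  shows "lookup (chromatic_polynomial G H) \<alpha> = lookup (chromatic_polynomial G H) \<beta>"
proof -
  let ?\<tau> = "Hilbert_Choice.inv \<sigma>"
  have \<tau>: "?\<tau> permutes {1..card (verts H)}"
    using \<sigma> by (rule permutes_inv)
  have undo: "restrict (\<rho> \<circ> restrict (\<pi> \<circ> f) A) A = f"
    if "f \<in> A \<rightarrow>\<^sub>E B" "\<And>x. \<rho> (\<pi> x) = x" for f :: "'z \<Rightarrow> nat" and \<rho> \<pi> A B
    using that by (auto simp: fun_eq_iff PiE_def extensional_def)
  have \<tau>\<sigma>: "?\<tau> (\<sigma> x) = x" "\<sigma> (?\<tau> x) = x" for x
    using permutes_inverses[OF \<sigma>] by auto
  have backL: "restrict (?\<tau> \<circ> restrict (\<sigma> \<circ> \<phi>) (verts H)) (verts H) = \<phi>"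
      "restrict (\<sigma> \<circ> restrict (?\<tau> \<circ> \<phi>) (verts H)) (verts H) = \<phi>" if "\<phi> \<in> labelings H" for \<phi>
    using that undo[of \<phi> "verts H"] \<tau>\<sigma> by (auto simp: labelings_def)
  have backC: "restrict (?\<tau> \<circ> restrict (\<sigma> \<circ> \<kappa>) (verts G)) (verts G) = \<kappa>"
      "restrict (\<sigma> \<circ> restrict (?\<tau> \<circ> \<kappa>) (verts G)) (verts G) = \<kappa>" if "\<kappa> \<in> proper_colorings G H \<phi>" for \<kappa> \<phi>
    using that undo[of \<kappa> "verts G"] \<tau>\<sigma> by (auto simp: proper_colorings_def)
  have count: "(\<forall>i. lookup \<beta> i = card {v \<in> verts G. restrict (\<sigma> \<circ> \<kappa>) (verts G) v = i})
      = (\<forall>i. lookup \<alpha> i = card {v \<in> verts G. \<kappa> v = i})" for \<kappa>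
  proof -
    have "{v \<in> verts G. restrict (\<sigma> \<circ> \<kappa>) (verts G) v = \<sigma> i} = {v \<in> verts G. \<kappa> v = i}" for i
      using \<tau>\<sigma>(1) by auto metis
    then have "(\<forall>i. lookup \<beta> (\<sigma> i) = card {v \<in> verts G. restrict (\<sigma> \<circ> \<kappa>) (verts G) v = \<sigma> i})
        = (\<forall>i. lookup \<alpha> i = card {v \<in> verts G. \<kappa> v = i})"
      using \<beta> by simp
    moreover have all: "(\<forall>i. P (\<sigma> i)) = (\<forall>i. P i)" for P
      using \<tau>\<sigma>(2) by metis
    ultimately show ?thesis
      using all[of "\<lambda>i. lookup \<beta> i = card {v \<in> verts G. restrict (\<sigma> \<circ> \<kappa>) (verts G) v = i}"]
      by argo
  qed
  show ?thesis
    unfolding lookup_chromatic_polynomial[OF fin]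
  proof (rule sum.reindex_bij_witness[where
        i = "\<lambda>\<phi>. restrict (?\<tau> \<circ> \<phi>) (verts H)" and j = "\<lambda>\<phi>. restrict (\<sigma> \<circ> \<phi>) (verts H)"])
    fix \<phi> assume \<phi>: "\<phi> \<in> labelings H"
    show "(\<Sum>\<kappa> \<in> proper_colorings G H (restrict (\<sigma> \<circ> \<phi>) (verts H)).
          if \<forall>i. lookup \<beta> i = card {v \<in> verts G. \<kappa> v = i} then 1 else 0)
        = (\<Sum>\<kappa> \<in> proper_colorings G H \<phi>.
          if \<forall>i. lookup \<alpha> i = card {v \<in> verts G. \<kappa> v = i} then 1 else (0::int))"
    proof (rule sum.reindex_bij_witness[symmetric, where
          i = "\<lambda>\<kappa>. restrict (?\<tau> \<circ> \<kappa>) (verts G)" and j = "\<lambda>\<kappa>. restrict (\<sigma> \<circ> \<kappa>) (verts G)"])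
      fix \<kappa> assume "\<kappa> \<in> proper_colorings G H (restrict (\<sigma> \<circ> \<phi>) (verts H))"
      from permuted_colorings[OF \<tau> permuted_labelings[OF \<sigma> \<phi>] this]
      show "restrict (?\<tau> \<circ> \<kappa>) (verts G) \<in> proper_colorings G H \<phi>"
        by (simp only: backL[OF \<phi>])
    qed (use permuted_colorings[OF \<sigma> \<phi>] backC count in \<open>simp_all only:\<close>)
  qed (use permuted_labelings \<sigma> \<tau> backL in blast)+
qed

lemma exponent_type_eq_imp_permutation:
  assumes "keys \<alpha> \<subseteq> {1..n}" "keys \<beta> \<subseteq> {1..n}" "exponent_type \<alpha> = exponent_type \<beta>"
  shows "\<exists>\<sigma>. \<sigma> permutes {1..n} \<and> (\<forall>i. lookup \<alpha> i = lookup \<beta> (\<sigma> i))"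
proof -
  have full: "image_mset (lookup \<gamma>) (mset_set {1..n})
      = exponent_type \<gamma> + replicate_mset (n - size (exponent_type \<gamma>)) 0"
    if "keys \<gamma> \<subseteq> {1..n}" for \<gamma> :: exponents
  proof -
    have "mset_set {1..n} = mset_set (keys \<gamma>) + mset_set ({1..n} - keys \<gamma>)"
      using that by (metis finite_atLeastAtMost finite_keys finite_Diff Diff_disjoint
          Diff_partition mset_set_Union)
    moreover have "image_mset (lookup \<gamma>) (mset_set ({1..n} - keys \<gamma>))
        = image_mset (\<lambda>_. 0) (mset_set ({1..n} - keys \<gamma>))"
      by (rule image_mset_cong) (auto simp: in_keys_iff)
    ultimately show ?thesis
      using that by (simp add: exponent_type_def image_mset_const_eq card_Diff_subset)
  qed
  have "image_mset (lookup \<alpha>) (mset_set {1..n}) = image_mset (lookup \<beta>) (mset_set {1..n})"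
    using full assms by metis
  then obtain \<sigma> where \<sigma>: "\<sigma> permutes {1..n}" "\<forall>i \<in> {1..n}. lookup \<alpha> i = lookup \<beta> (\<sigma> i)"
    by (rule image_mset_eq_implies_permutes[rotated]) auto
  have "lookup \<alpha> i = lookup \<beta> (\<sigma> i)" if "i \<notin> {1..n}" for i
  proof -
    have "i \<notin> keys \<alpha>" "i \<notin> keys \<beta>"
      using assms that by auto
    then show ?thesis
      using that \<sigma>(1) by (simp add: permutes_not_in in_keys_iff)
  qed
  then show ?thesis
    using \<sigma> by blast
qed

lemma chromatic_polynomial_support:
  assumes fin: "finite (verts G)" and nz: "lookup (chromatic_polynomial G H) \<alpha> \<noteq> 0"
  shows "keys \<alpha> \<subseteq> {1..card (verts H)}" "(\<Sum>i \<in> keys \<alpha>. lookup \<alpha> i) = card (verts G)"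
proof -
  obtain \<phi> \<kappa> where \<kappa>: "\<kappa> \<in> proper_colorings G H \<phi>"
    and *: "\<forall>i. lookup \<alpha> i = card {v \<in> verts G. \<kappa> v = i}"
  proof -
    obtain \<phi> where "(\<Sum>\<kappa> \<in> proper_colorings G H \<phi>.
        if \<forall>i. lookup \<alpha> i = card {v \<in> verts G. \<kappa> v = i} then 1 else 0) \<noteq> (0::int)"
      using nz unfolding lookup_chromatic_polynomial[OF fin]
      by (rule sum.not_neutral_contains_not_neutral)
    then obtain \<kappa> where "\<kappa> \<in> proper_colorings G H \<phi>"
      "(if \<forall>i. lookup \<alpha> i = card {v \<in> verts G. \<kappa> v = i} then 1 else 0) \<noteq> (0::int)"
      by (rule sum.not_neutral_contains_not_neutral)
    then show thesis
      using that by metis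
  qed
  have keys: "keys \<alpha> = \<kappa> ` verts G"
    using * fin by (auto simp: in_keys_iff card_eq_0_iff)
  then show "keys \<alpha> \<subseteq> {1..card (verts H)}"
    using \<kappa> by (auto simp: proper_colorings_def PiE_iff)
  have "(\<Sum>i \<in> keys \<alpha>. lookup \<alpha> i) = (\<Sum>i \<in> \<kappa> ` verts G. card {v \<in> verts G. \<kappa> v = i})"
    using * keys by simp
  also have "\<dots> = card (verts G)"
    using sum.image_gen[OF fin, of "\<lambda>_. 1::nat" \<kappa>] by simp
  finally show "(\<Sum>i \<in> keys \<alpha>. lookup \<alpha> i) = card (verts G)" .
qed

theorem monomial_expansion_chromatic_polynomial:
  assumes "finite (verts G)"
  shows "\<exists>!c. monomial_expansion (chromatic_polynomial G H) (card (verts G)) (card (verts H)) c"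
proof -
  define k n w where "k = card (verts G)" and "n = card (verts H)" and "w = chromatic_polynomial G H"
  define c where "c \<mu> = (if \<mu> \<in> partitions k n
      then lookup w (SOME \<alpha>. keys \<alpha> \<subseteq> {1..n} \<and> exponent_type \<alpha> = \<mu>) else 0)" for \<mu>
  have c: "c (exponent_type \<alpha>) = lookup w \<alpha>"
    if \<alpha>: "keys \<alpha> \<subseteq> {1..n}" "exponent_type \<alpha> \<in> partitions k n" for \<alpha>
  proof -
    define \<beta> where "\<beta> = (SOME \<beta>. keys \<beta> \<subseteq> {1..n} \<and> exponent_type \<beta> = exponent_type \<alpha>)"
    have "keys \<beta> \<subseteq> {1..n} \<and> exponent_type \<beta> = exponent_type \<alpha>"
      unfolding \<beta>_def using ex_exponents_of_type[OF \<alpha>(2)] by (rule someI_ex)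
    then obtain \<sigma> where "\<sigma> permutes {1..n}" "\<And>i. lookup \<beta> i = lookup \<alpha> (\<sigma> i)"
      using exponent_type_eq_imp_permutation \<alpha>(1) by metis
    then have "lookup w \<beta> = lookup w \<alpha>"
      unfolding w_def n_def by (intro lookup_chromatic_polynomial_permute[OF assms])
    then show ?thesis
      using \<alpha>(2) by (simp add: c_def \<beta>_def)
  qed
  have expand: "lookup w \<alpha> = (\<Sum>\<mu> \<in> partitions k n. c \<mu> * monomial_symmetric {1..n} \<mu> \<alpha>)" for \<alpha>
  proof (cases "keys \<alpha> \<subseteq> {1..n} \<and> exponent_type \<alpha> \<in> partitions k n")
    case True
    then show ?thesis
      using sum_monomial_symmetric[of \<alpha> n k c] c[of \<alpha>] by simp
  next
    case False
    then have "lookup w \<alpha> = 0"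
      using chromatic_polynomial_support[OF assms, of H \<alpha>] exponent_type_in_partitions[of \<alpha> n]
      unfolding w_def n_def k_def by metis
    moreover have "(\<Sum>\<mu> \<in> partitions k n. c \<mu> * monomial_symmetric {1..n} \<mu> \<alpha>) = 0"
      using False by (intro sum.neutral) (auto simp: monomial_symmetric_def)
    ultimately show ?thesis
      by simp
  qed
  have "c \<mu> = 0" if "\<mu> \<notin> partitions k n" for \<mu>
    using that by (simp add: c_def)
  with expand have ex: "monomial_expansion w k n c"
    unfolding monomial_expansion_def by blast
  have "d = c" if d: "monomial_expansion w k n d" for d
  proof
    fix \<mu>
    show "d \<mu> = c \<mu>"
    proof (cases "\<mu> \<in> partitions k n")
      case True
      then obtain \<alpha> where \<alpha>: "keys \<alpha> \<subseteq> {1..n}" "exponent_type \<alpha> = \<mu>"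
        using ex_exponents_of_type by blast
      then have "lookup w \<alpha> = d \<mu>"
        using d True sum_monomial_symmetric[of \<alpha> n k d]
        by (simp add: monomial_expansion_def)
      then show ?thesis
        using c[of \<alpha>] \<alpha> True by simp
    next
      case False
      then show ?thesis
        using d ex by (simp add: monomial_expansion_def)
    qed
  qed
  then show ?thesis
    using ex unfolding w_def k_def n_def by blast
qed

lemma bipartition_unique:
  assumes "strongly_connected C" "bipartition C V1 V2" "bipartition C W1 W2"
  shows "W1 = V1 \<and> W2 = V2 \<or> W1 = V2 \<and> W2 = V1"
proof -
  obtain u where u: "u \<in> verts C"
    using assms(1) by (auto simp: strongly_connected_def)
  have "(v \<in> V1 \<longleftrightarrow> v \<in> W1) = (u \<in> V1 \<longleftrightarrow> u \<in> W1)" if v: "v \<in> verts C" for v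
  proof -
    have "u \<rightarrow>\<^sup>*\<^bsub>C\<^esub> v"
      using assms(1) u v by (auto simp: strongly_connected_def)
    then have "(u, v) \<in> rtrancl_on (verts C) (arcs_ends C)"
      by (simp add: reachable_def)
    then show ?thesis
    proof induction
      case (step x y)
      then have "(x \<in> V1) \<noteq> (y \<in> V1)" "(x \<in> W1) \<noteq> (y \<in> W1)"
        using assms(2,3) unfolding bipartition_def by (auto dest!: subsetD)
      then show ?case
        using step by auto
    qed simp
  qed
  then have agree: "(\<forall>v \<in> verts C. v \<in> W1 \<longleftrightarrow> v \<in> V1) \<or> (\<forall>v \<in> verts C. v \<in> W1 \<longleftrightarrow> v \<notin> V1)"
    by metis
  have V: "V1 \<subseteq> verts C" "V2 = verts C - V1" and W: "W1 \<subseteq> verts C" "W2 = verts C - W1"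
    using assms(2,3) by (auto simp: bipartition_def)
  from agree show ?thesis
  proof
    assume "\<forall>v \<in> verts C. v \<in> W1 \<longleftrightarrow> v \<in> V1"
    then have "W1 = V1"
      using V(1) W(1) by auto
    then show ?thesis
      using V(2) W(2) by simp
  next
    assume "\<forall>v \<in> verts C. v \<in> W1 \<longleftrightarrow> v \<notin> V1"
    then have "W1 = verts C - V1"
      using W(1) by auto
    then show ?thesis
      using V W(2) by auto
  qed
qed

theorem part_size_multiset_eq:
  fixes V :: "('a, 'b) pre_digraph \<Rightarrow> nat \<Rightarrow> 'a set"
  assumes V: "\<And>C. C \<in> pre_digraph.sccs G \<Longrightarrow> bipartition C (V C 1) (V C 2)"
  shows "part_size_multiset G =
    {# \<Sum>C \<in> pre_digraph.sccs G. card (V C (p C)). p \<in># mset_set (pre_digraph.sccs G \<rightarrow>\<^sub>E {1, 2}) #}"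
proof -
  let ?S = "pre_digraph.sccs G"
  let ?P = "?S \<rightarrow>\<^sub>E {1, 2::nat}"
  define swap where "swap p = restrict (\<lambda>C. if part C 1 = V C 1 then p C else 3 - p C) ?S"
    for p :: "('a, 'b) pre_digraph \<Rightarrow> nat"
  have flip: "3 - x \<in> {1, 2}" "3 - (3 - x) = x" if "x \<in> {1, 2}" for x :: nat
    using that by auto
  have swap_in: "swap p \<in> ?P" if "p \<in> ?P" for p
    unfolding swap_def restrict_PiE_iff
  proof
    fix C assume "C \<in> ?S"
    then show "(if part C 1 = V C 1 then p C else 3 - p C) \<in> {1, 2}"
      using PiE_mem[OF that] flip(1) by presburger
  qed
  have swap_swap: "swap (swap p) = p" if p: "p \<in> ?P" for p
  proof
    fix C
    show "swap (swap p) C = p C"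
      using PiE_mem[OF p, of C, THEN flip(2)] PiE_arb[OF p, of C] by (auto simp: swap_def)
  qed
  have "bij_betw swap ?P ?P"
    by (rule bij_betw_byWitness[where f' = swap]) (use swap_swap swap_in in blast)+
  then have "mset_set ?P = image_mset swap (mset_set ?P)"
    by (simp add: bij_betw_def image_mset_mset_set)
  then have "{# \<Sum>C \<in> ?S. card (V C (p C)). p \<in># mset_set ?P #}
      = image_mset (\<lambda>p. \<Sum>C \<in> ?S. card (V C (p C))) (image_mset swap (mset_set ?P))"
    by (rule arg_cong)
  also have "\<dots> = {# \<Sum>C \<in> ?S. card (V C (swap p C)). p \<in># mset_set ?P #}"
    by (simp only: image_mset.compositionality comp_def)
  also have "\<dots> = part_size_multiset G"
    unfolding part_size_multiset_def
  proof (rule image_mset_cong, rule sum.cong[OF refl])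
    fix p C assume "p \<in># mset_set ?P" and C: "C \<in> ?S"
    then have "p \<in> ?P"
      by (metis elem_mset_set empty_iff mset_set.infinite set_mset_empty)
    then have p: "p C = 1 \<or> p C = 2"
      using C by (auto simp: PiE_iff)
    have "bipartition C (part C 1) (part C 2)"
      unfolding part_def using V[OF C] by (rule someI[where P = "\<lambda>V. bipartition C (V 1) (V 2)"])
    moreover have "strongly_connected C"
      using C by (simp add: pre_digraph.sccs_def)
    ultimately have "part C 1 = V C 1 \<and> part C 2 = V C 2 \<or> part C 1 = V C 2 \<and> part C 2 = V C 1"
      using bipartition_unique V[OF C] by blast
    then show "card (V C (swap p C)) = card (part C (p C))"
      using p C by (auto simp: swap_def)
  qed
  finally show ?thesis ..
qed

end

theory Submission
  imports Defs
begin

text \<open>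
  Let \<open>b\<^sub>j\<close> be the number of ordered bipartitions \<open>(A, V(G) - A)\<close> of \<open>G\<close> with \<open>|A| = j\<close>; this is the
  multiplicity of \<open>j\<close> in \<open>S(G)\<close>. A coloring is proper for a labeling of \<open>K\<^bsub>m,n\<^esub>\<close> iff the preimage
  of the labels \<open>P\<close> of the first side is one side of a bipartition of \<open>G\<close>, so each labeling
  contributes \<open>\<Sum>\<^sub>j b\<^sub>j x\<^sub>P\<^sup>j x\<^sub>Q\<^sup>k\<^sup>-\<^sup>j\<close> to \<open>w\<close>, where \<open>Q\<close> is the complement of \<open>P\<close> and \<open>x\<^sub>P\<close>, \<open>x\<^sub>Q\<close> are the
  sums of the variables indexed by \<open>P\<close> and \<open>Q\<close>. Hence \<open>S(G)\<close> determines \<open>w\<close>. Conversely, the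
  coefficient of \<open>x\<^sub>1\<^sup>a x\<^sub>2\<^sup>k\<^sup>-\<^sup>a\<close> in \<open>w\<close> is \<open>s (k choose a) b\<^sub>0 + d b\<^sub>a\<close>, where \<open>s\<close> and \<open>d\<close> count the labelings
  that put the labels \<open>1\<close> and \<open>2\<close> on the same side and on different sides. Since \<open>d > 0\<close>, the
  case \<open>a = 0\<close> determines \<open>b\<^sub>0\<close>, and then every \<open>b\<^sub>a\<close> is determined.
\<close>

section \<open>Ordered bipartitions, recorded by their first side\<close>

definition sides :: "('a, 'b) pre_digraph \<Rightarrow> 'a set set"
  where "sides G = {A. bipartition G A (verts G - A)}"

lemma finite_sides: "finite (verts G) \<Longrightarrow> finite (sides G)"
  by (rule finite_subset[of _ "Pow (verts G)"]) (auto simp: sides_def bipartition_def)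

lemma sides_subset: "A \<in> sides G \<Longrightarrow> A \<subseteq> verts G"
  by (auto simp: sides_def bipartition_def)

lemma bipartition_iff:
  "bipartition G V W \<longleftrightarrow> verts G = V \<union> W \<and> V \<inter> W = {} \<and>
    (\<forall>u v. u \<rightarrow>\<^bsub>G\<^esub> v \<longrightarrow> u \<in> V \<and> v \<in> W \<or> u \<in> W \<and> v \<in> V)"
  unfolding bipartition_def subset_iff by auto

text \<open>With the second side fixed as the complement, all that remains of a bipartition is that
  \<open>A\<close> separates the two ends of every arc.\<close>

lemma in_sides_iff:
  assumes "wf_digraph G" "A \<subseteq> verts G"
  shows "A \<in> sides G \<longleftrightarrow> (\<forall>u v. u \<rightarrow>\<^bsub>G\<^esub> v \<longrightarrow> (u \<in> A) \<noteq> (v \<in> A))"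
proof -
  have "u \<in> verts G \<and> v \<in> verts G" if "u \<rightarrow>\<^bsub>G\<^esub> v" for u v
    using that wf_digraph.adj_in_verts[OF assms(1)] by blast
  then show ?thesis
    using assms(2) unfolding sides_def bipartition_iff mem_Collect_eq by blast
qed

text \<open>Complementation negates both memberships in the separation condition. This serves the
  labelings that put 2 on the first side of \<open>H\<close>, where the relevant preimage is the
  complement of \<open>{}\<close> or of a color class.\<close>

lemma Compl_in_sides_iff:
  assumes "wf_digraph G" "A \<subseteq> verts G"
  shows "verts G - A \<in> sides G \<longleftrightarrow> A \<in> sides G"
  using assms wf_digraph.adj_in_verts[OF assms(1)]
  unfolding in_sides_iff[OF assms] in_sides_iff[OF assms(1) Diff_subset] by blast

lemma bipartition_subgraph:
  assumes "subgraph C G" "bipartition G V W"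
  shows "bipartition C (V \<inter> verts C) (W \<inter> verts C)"
proof -
  interpret C: wf_digraph C
    using assms(1) by (auto simp: subgraph_def)
  have "(u, v) \<in> arcs_ends G \<and> u \<in> verts C \<and> v \<in> verts C" if "(u, v) \<in> arcs_ends C" for u v
    using that arcs_ends_mono[OF assms(1)] C.adj_in_verts[OF that] by blast
  moreover have "verts C \<subseteq> verts G"
    using assms(1) by (auto simp: subgraph_def)
  ultimately show ?thesis
    using assms(2) unfolding bipartition_iff by blast
qed

section \<open>Connected components and the multiset \<open>S(G)\<close>\<close>

context graph
begin

lemma finite_sccs: "finite sccs"
  using finite_sccs_verts inj_on_verts_sccs by (simp add: sccs_verts_conv finite_image_iff)

lemma verts_eq_Union_sccs: "verts G = (\<Union>C \<in> sccs. verts C)"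
  using scc_for_vert_ex by (auto simp: sccs_def induced_subgraph_def subgraph_def)

text \<open>Symmetry of the arcs makes reachability symmetric, so the strong component of
  \<open>u\<close> also contains \<open>v\<close>; being an induced subgraph, it keeps the
  arc.\<close>

lemma arc_in_scc:
  assumes "u \<rightarrow> v"
  shows "\<exists>C \<in> sccs. u \<rightarrow>\<^bsub>C\<^esub> v"
proof -
  have "scc_of u \<in> sccs_verts" "u \<in> scc_of u" "v \<in> scc_of u"
    using assms symmetric_reachable'[OF reachable_adjI[OF assms]]
      scc_of_in_sccs_verts[of u] in_scc_of_self[of u] adj_in_verts[OF assms]
    by (auto simp: scc_of_def)
  moreover from this have "G \<restriction> scc_of u \<in> sccs"
    by (simp add: in_sccs_verts_conv)
  moreover have "u \<rightarrow>\<^bsub>G \<restriction> scc_of u\<^esub> v"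
    using assms calculation by (auto simp: arcs_ends_def arc_to_ends_def)
  ultimately show ?thesis
    by blast
qed

text \<open>Choosing one part in every component and taking the union gives a side of
  \<open>G\<close>. Conversely a side restricts to a part of each component, because a connected
  graph has only one bipartition up to order. This bijection turns sums of part sizes into
  cardinalities of sides.\<close>

lemma part_size_multiset_eq_card_sides:
  assumes "bipartite G"
  shows "part_size_multiset G = image_mset card (mset_set (sides G))"
proof -
  let ?P = "sccs \<rightarrow>\<^sub>E {1, 2::nat}"
  define f where "f p = (\<Union>C \<in> sccs. part C (p C))" for p :: "('a, 'b) pre_digraph \<Rightarrow> nat"
  have sub: "subgraph C G" "strongly_connected C" if "C \<in> sccs" for C
    using that by (auto simp: sccs_def induced_subgraph_def)
  have bip: "bipartition C (part C 1) (part C 2)" if C: "C \<in> sccs" for C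
  proof -
    obtain V W where "bipartition G V W"
      using assms by (auto simp: bipartite_def)
    \<comment> \<open>\<open>part\<close> chooses a function of the index, so the witness for
      \<open>someI\<close> must be packed into such a function as well.\<close>
    then have "bipartition C ((\<lambda>i. if i = 1 then V \<inter> verts C else W \<inter> verts C) (1::nat))
        ((\<lambda>i. if i = 1 then V \<inter> verts C else W \<inter> verts C) (2::nat))"
      using bipartition_subgraph[OF sub(1)[OF C]] by simp
    then show ?thesis
      unfolding part_def by (rule someI[where P = "\<lambda>V. bipartition C (V 1) (V 2)"])
  qed
  have part_sub: "part C (p C) \<subseteq> verts C" if "p \<in> ?P" "C \<in> sccs" for p C
    using bip[OF that(2)] PiE_mem[OF that] by (auto simp: bipartition_def)
  have disj: "C = D" if "C \<in> sccs" "D \<in> sccs" "x \<in> verts C" "x \<in> verts D" for C D x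
    using scc_disj that by blast
  \<comment> \<open>Distinct components share no vertex, so the union meets \<open>C\<close> exactly
    in the part chosen there. Both the separation of arcs and injectivity reduce to this.\<close>
  have f_int: "f p \<inter> verts C = part C (p C)" if "p \<in> ?P" "C \<in> sccs" for p C
  proof
    show "f p \<inter> verts C \<subseteq> part C (p C)"
    proof
      fix x assume "x \<in> f p \<inter> verts C"
      then obtain D where "D \<in> sccs" "x \<in> part D (p D)" "x \<in> verts C"
        by (auto simp: f_def)
      then show "x \<in> part C (p C)"
        using disj[OF that(2), of D x] part_sub[OF that(1), of D] by blast
    qed
    show "part C (p C) \<subseteq> f p \<inter> verts C"
      using that part_sub by (auto simp: f_def)
  qed
  have f_sides: "f p \<in> sides G" if p: "p \<in> ?P" for p
  proof -
    have "f p \<subseteq> verts G"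
      using part_sub[OF p] verts_eq_Union_sccs by (auto simp: f_def)
    moreover have "(u \<in> f p) \<noteq> (v \<in> f p)" if "u \<rightarrow> v" for u v
    proof -
      obtain C where C: "C \<in> sccs" "u \<rightarrow>\<^bsub>C\<^esub> v"
        using arc_in_scc[OF \<open>u \<rightarrow> v\<close>] by blast
      then have "u \<in> verts C" "v \<in> verts C"
        using sub(1)[OF C(1)] by (auto simp: subgraph_def dest: wf_digraph.adj_in_verts)
      moreover have "(u \<in> part C (p C)) \<noteq> (v \<in> part C (p C))"
        using bip[OF C(1), unfolded bipartition_iff] C(2) PiE_mem[OF p C(1)]
        by (elim insertE; metis Int_iff empty_iff)
      ultimately show ?thesis
        using f_int[OF p C(1)] by blast
    qed
    ultimately show ?thesis
      using in_sides_iff[OF wf_digraph_axioms] by blast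
  qed
  have inj: "inj_on f ?P"
  proof (rule inj_onI)
    fix p q assume p: "p \<in> ?P" and q: "q \<in> ?P" and eq: "f p = f q"
    show "p = q"
    proof (rule PiE_ext[OF p q])
      fix C assume C: "C \<in> sccs"
      have "part C (p C) = part C (q C)"
        using f_int[OF p C] f_int[OF q C] eq by simp
      \<comment> \<open>The parts are disjoint and cover a nonempty component, so they differ even
        when one of them is empty, as for an isolated vertex.\<close>
      moreover have "part C 1 \<noteq> part C 2"
        using bip[OF C] sub(2)[OF C] by (auto simp: bipartition_def strongly_connected_def)
      ultimately show "p C = q C"
        using PiE_mem[OF p C] PiE_mem[OF q C] by auto
    qed
  qed
  have surj: "A \<in> f ` ?P" if A: "A \<in> sides G" for A
  proof -
    have "\<exists>i \<in> {1, 2}. A \<inter> verts C = part C i" if C: "C \<in> sccs" for C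
      using bipartition_unique[OF sub(2)[OF C] bip[OF C]]
        bipartition_subgraph[OF sub(1)[OF C], of A "verts G - A"] A
      by (auto simp: sides_def)
    then obtain q where q: "\<And>C. C \<in> sccs \<Longrightarrow> q C \<in> {1, 2} \<and> A \<inter> verts C = part C (q C)"
      by metis
    define p where "p = restrict q sccs"
    have p: "p \<in> ?P" "\<And>C. C \<in> sccs \<Longrightarrow> part C (p C) = A \<inter> verts C"
      using q by (auto simp: p_def)
    then have "f p = A \<inter> verts G"
      by (auto simp: f_def verts_eq_Union_sccs)
    then show ?thesis
      using p(1) sides_subset[OF A] by (auto simp: Int_absorb2)
  qed
  have card_f: "card (f p) = (\<Sum>C \<in> sccs. card (part C (p C)))" if p: "p \<in> ?P" for p
    unfolding f_def
  proof (rule card_UN_disjoint[OF finite_sccs])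
    show "\<forall>C \<in> sccs. finite (part C (p C))"
      using part_sub[OF p] verts_eq_Union_sccs by (blast intro: finite_subset[OF _ finite_verts])
    show "\<forall>C \<in> sccs. \<forall>D \<in> sccs. C \<noteq> D \<longrightarrow> part C (p C) \<inter> part D (p D) = {}"
      using part_sub[OF p] disj by blast
  qed
  have "f ` ?P = sides G"
    using surj f_sides by blast
  then have "mset_set (sides G) = image_mset f (mset_set ?P)"
    using image_mset_mset_set[OF inj] by simp
  then have "image_mset card (mset_set (sides G)) = image_mset (\<lambda>p. card (f p)) (mset_set ?P)"
    by (simp add: image_mset.compositionality comp_def)
  also have "\<dots> = part_size_multiset G"
    unfolding part_size_multiset_def
  proof (rule image_mset_cong)
    fix p assume "p \<in># mset_set ?P"
    then show "card (f p) = (\<Sum>C \<in> sccs. card (part C (p C)))"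
      using card_f finite_PiE[OF finite_sccs, of "\<lambda>_. {1, 2::nat}"] by simp
  qed
  finally show ?thesis ..
qed

lemma part_size_multiset_le:
  assumes "bipartite G" "a \<in># part_size_multiset G"
  shows "a \<le> card (verts G)"
  using assms(2) finite_sides[OF finite_verts] card_mono[OF finite_verts sides_subset]
  unfolding part_size_multiset_eq_card_sides[OF assms(1)] by auto

end

section \<open>Proper colorings by a complete bipartite graph\<close>

lemma labelings_image:
  assumes "\<phi> \<in> labelings H" "U \<subseteq> verts H" "i \<in> {1..card (verts H)}"
  shows "inv_into (verts H) \<phi> i \<in> U \<longleftrightarrow> i \<in> \<phi> ` U"
proof -
  have bij: "bij_betw \<phi> (verts H) {1..card (verts H)}"
    using assms(1) by (simp add: labelings_def)
  then have "i \<in> \<phi> ` verts H"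
    using assms(3) by (simp add: bij_betw_def)
  then have "\<phi> (inv_into (verts H) \<phi> i) = i"
    by (rule f_inv_into_f)
  moreover have "inv_into (verts H) \<phi> (\<phi> u) = u" if "u \<in> U" for u
    using bij assms(2) that by (auto simp: bij_betw_def)
  ultimately show ?thesis
    by (metis image_iff)
qed

text \<open>Adjacency in \<open>H\<close> means lying on different sides, so properness asks that
  every arc of \<open>G\<close> have exactly one end colored from the labels of \<open>U\<close>.
  This is the separation condition for the preimage of those labels.\<close>

lemma proper_colorings_complete_bipartite:
  assumes "wf_digraph G" "verts H = U \<union> V" "U \<inter> V = {}" "arcs_ends H = U \<times> V \<union> V \<times> U"
    and \<phi>: "\<phi> \<in> labelings H"
  shows "proper_colorings G H \<phi> =
    {\<kappa> \<in> verts G \<rightarrow>\<^sub>E {1..card (verts H)}. {v \<in> verts G. \<kappa> v \<in> \<phi> ` U} \<in> sides G}"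
proof -
  have "(\<forall>u \<in> verts G. \<forall>v \<in> verts G. u \<rightarrow>\<^bsub>G\<^esub> v \<longrightarrow>
        inv_into (verts H) \<phi> (\<kappa> u) \<rightarrow>\<^bsub>H\<^esub> inv_into (verts H) \<phi> (\<kappa> v))
      \<longleftrightarrow> {v \<in> verts G. \<kappa> v \<in> \<phi> ` U} \<in> sides G"
    if \<kappa>: "\<kappa> \<in> verts G \<rightarrow>\<^sub>E {1..card (verts H)}" for \<kappa>
  proof -
    let ?h = "inv_into (verts H) \<phi>"
    have adj: "(?h (\<kappa> u) \<rightarrow>\<^bsub>H\<^esub> ?h (\<kappa> v)) = ((\<kappa> u \<in> \<phi> ` U) \<noteq> (\<kappa> v \<in> \<phi> ` U))"
      if "u \<in> verts G" "v \<in> verts G" for u v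
    proof -
      have *: "\<kappa> u \<in> {1..card (verts H)}" "\<kappa> v \<in> {1..card (verts H)}"
        using \<kappa> that by (metis PiE_mem)+
      then have "?h (\<kappa> u) \<in> verts H" "?h (\<kappa> v) \<in> verts H"
        using \<phi> by (metis (no_types, lifting) bij_betw_imp_surj_on inv_into_into labelings_def
            mem_Collect_eq)+
      then have "(?h (\<kappa> u) \<rightarrow>\<^bsub>H\<^esub> ?h (\<kappa> v)) = ((?h (\<kappa> u) \<in> U) \<noteq> (?h (\<kappa> v) \<in> U))"
        using assms(2-4) by auto
      then show ?thesis
        using labelings_image[OF \<phi>, of U] * assms(2) by simp
    qed
    have "u \<in> verts G \<and> v \<in> verts G" if "u \<rightarrow>\<^bsub>G\<^esub> v" for u v
      using that wf_digraph.adj_in_verts[OF assms(1)] by blast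
    then show ?thesis
      using adj in_sides_iff[OF assms(1), of "{v \<in> verts G. \<kappa> v \<in> \<phi> ` U}"] by blast
  qed
  then show ?thesis
    unfolding proper_colorings_def by blast
qed

text \<open>Colorings are grouped by the preimage \<open>A\<close> of the labels of
  \<open>U\<close>. Within a group the vertices choose their colors independently, so the sum of
  products factors into one linear form per vertex.\<close>

lemma sum_proper_colorings_complete_bipartite:
  assumes "wf_digraph G" and fin: "finite (verts G)"
    and "verts H = U \<union> V" "U \<inter> V = {}" "arcs_ends H = U \<times> V \<union> V \<times> U"
    and \<phi>: "\<phi> \<in> labelings H"
  shows "(\<Sum>\<kappa> \<in> proper_colorings G H \<phi>. \<Prod>v \<in> verts G. var (\<kappa> v)) =
    (\<Sum>A \<in> sides G. (\<Sum>i \<in> \<phi> ` U. var i) ^ card A *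
       (\<Sum>i \<in> {1..card (verts H)} - \<phi> ` U. var i) ^ (card (verts G) - card A))"
proof -
  let ?N = "{1..card (verts H)}" and ?P = "\<phi> ` U"
  define F where "F A = PiE (verts G) (\<lambda>v. if v \<in> A then ?P else ?N - ?P)" for A
  have P: "?P \<subseteq> ?N"
    using \<phi> assms(3) by (auto simp: labelings_def PiE_iff)
  then have finP: "finite ?P"
    by (rule finite_subset) simp
  \<comment> \<open>\<open>F A\<close> is at once a product set, which lets the sum factor, and the
    fibre over \<open>A\<close> of the preimage map, which makes these sets pairwise
    disjoint.\<close>
  have F: "F A = {\<kappa> \<in> verts G \<rightarrow>\<^sub>E ?N. {v \<in> verts G. \<kappa> v \<in> ?P} = A}" if "A \<in> sides G" for A
  proof -
    have iff: "(i \<in> (if v \<in> A then ?P else ?N - ?P)) \<longleftrightarrow> i \<in> ?N \<and> (i \<in> ?P \<longleftrightarrow> v \<in> A)" for i v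
      using P by auto
    have eq: "{v \<in> verts G. \<kappa> v \<in> ?P} = A \<longleftrightarrow> (\<forall>v \<in> verts G. \<kappa> v \<in> ?P \<longleftrightarrow> v \<in> A)" for \<kappa>
      using sides_subset[OF that] by blast
    show ?thesis
      by (rule set_eqI) (unfold F_def mem_Collect_eq PiE_iff iff eq, blast)
  qed
  have "proper_colorings G H \<phi> = (\<Union>A \<in> sides G. F A)"
    using proper_colorings_complete_bipartite[OF assms(1,3-6)] F by auto
  then have "(\<Sum>\<kappa> \<in> proper_colorings G H \<phi>. \<Prod>v \<in> verts G. var (\<kappa> v))
      = (\<Sum>A \<in> sides G. \<Sum>\<kappa> \<in> F A. \<Prod>v \<in> verts G. var (\<kappa> v))"
    using finite_sides[OF fin] finP fin F
    by (simp only:) (intro sum.UNION_disjoint, auto simp: F_def intro!: finite_PiE)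
  also have "\<dots> = (\<Sum>A \<in> sides G. (\<Sum>i \<in> ?P. var i) ^ card A *
       (\<Sum>i \<in> ?N - ?P. var i) ^ (card (verts G) - card A))"
  proof (rule sum.cong[OF refl])
    fix A assume A: "A \<in> sides G"
    have "(\<Sum>\<kappa> \<in> F A. \<Prod>v \<in> verts G. var (\<kappa> v))
        = (\<Prod>v \<in> verts G. \<Sum>i \<in> (if v \<in> A then ?P else ?N - ?P). var i)"
      unfolding F_def by (rule prod_sum_PiE[symmetric]) (use fin finP in auto)
    also have "\<dots> = (\<Prod>v \<in> verts G. if v \<in> A then \<Sum>i \<in> ?P. var i else \<Sum>i \<in> ?N - ?P. var i)"
      by (intro prod.cong) auto
    also have "\<dots> = (\<Sum>i \<in> ?P. var i) ^ card A * (\<Sum>i \<in> ?N - ?P. var i) ^ card (verts G - A)"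
      using fin sides_subset[OF A] by (simp add: prod.If_cases Int_absorb1 Diff_eq)
    also have "card (verts G - A) = card (verts G) - card A"
      using fin sides_subset[OF A] by (simp add: card_Diff_subset finite_subset)
    finally show "(\<Sum>\<kappa> \<in> F A. \<Prod>v \<in> verts G. var (\<kappa> v)) = (\<Sum>i \<in> ?P. var i) ^ card A *
       (\<Sum>i \<in> ?N - ?P. var i) ^ (card (verts G) - card A)" .
  qed
  finally show ?thesis .
qed

text \<open>The summand of a side depends only on its cardinality, so \<open>G\<close> enters only
  through \<open>S(G)\<close> and its number of vertices. This gives the direction from
  \<open>S(G)\<close> to the symmetric function.\<close>

lemma chromatic_polynomial_complete_bipartite:
  assumes "graph G" "bipartite G"
    and "verts H = U \<union> V" "U \<inter> V = {}" "arcs_ends H = U \<times> V \<union> V \<times> U"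
  shows "chromatic_polynomial G H = (\<Sum>\<phi> \<in> labelings H.
    \<Sum>j \<in># part_size_multiset G. (\<Sum>i \<in> \<phi> ` U. var i) ^ j *
       (\<Sum>i \<in> {1..card (verts H)} - \<phi> ` U. var i) ^ (card (verts G) - j))"
proof -
  interpret graph G by fact
  show ?thesis
    unfolding chromatic_polynomial_def part_size_multiset_eq_card_sides[OF assms(2)]
    using sum_proper_colorings_complete_bipartite[OF wf_digraph_axioms finite_verts assms(3-5)]
    by (intro sum.cong) (auto simp: sum_unfold_sum_mset image_mset.compositionality comp_def)
qed

text \<open>On exponents supported on the labels of \<open>H\<close>, the monomial symmetric
  functions in finitely and in infinitely many variables agree, so the converse can compare
  coefficients of the polynomials.\<close>

lemma chromatic_symmetric_function_eq_lookup:
  assumes "finite (verts G)" "keys \<alpha> \<subseteq> {1..card (verts H)}"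
  shows "chromatic_symmetric_function G H \<alpha> = lookup (chromatic_polynomial G H) \<alpha>"
proof -
  have "monomial_expansion (chromatic_polynomial G H) (card (verts G)) (card (verts H))
      (chromatic_coeff G H)"
    unfolding chromatic_coeff_def by (rule theI'[OF monomial_expansion_chromatic_polynomial[OF assms(1)]])
  moreover have "monomial_symmetric {1..} \<mu> \<alpha> = monomial_symmetric {1..card (verts H)} \<mu> \<alpha>" for \<mu>
    using assms(2) by (auto simp: monomial_symmetric_def)
  ultimately show ?thesis
    unfolding chromatic_symmetric_function_def monomial_expansion_def by simp
qed

lemma chromatic_symmetric_function_cong:
  assumes "card (verts G) = card (verts G')" "chromatic_polynomial G H = chromatic_polynomial G' H"
  shows "chromatic_symmetric_function G H = chromatic_symmetric_function G' H"
  using assms by (simp add: chromatic_symmetric_function_def chromatic_coeff_def)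

section \<open>Coefficients of monomials in the first two variables\<close>

lemma count_image_card_mset_set:
  assumes "finite S"
  shows "count (image_mset card (mset_set S)) j = card {A \<in> S. card A = j}"
  using assms by (simp add: count_image_mset Int_def vimage_def conj_commute sum.If_cases)

lemma lookup_two_variables:
  fixes a b i :: nat
  shows "lookup (Poly_Mapping.single 1 a + Poly_Mapping.single 2 b) i =
    (if i = 1 then a else if i = 2 then b else (0::nat))"
  by (simp add: lookup_add lookup_single when_def)

text \<open>The prescribed class sizes leave no vertex for a third color, so a coloring is
  determined by the class of color 1, which may be any set of size \<open>a\<close>.\<close>

lemma colorings_two_labels:
  fixes N :: nat
  assumes fin: "finite V" and "a \<le> card V" "2 \<le> N"
  shows "bij_betw (\<lambda>A. \<lambda>v \<in> V. if v \<in> A then 1 else 2) {A. A \<subseteq> V \<and> card A = a}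
    {\<kappa> \<in> V \<rightarrow>\<^sub>E {1..N}. \<forall>i. (if i = 1 then a else if i = 2 then card V - a else 0)
       = card {v \<in> V. \<kappa> v = i}}"
    (is "bij_betw ?f ?S ?T")
proof (rule bij_betw_byWitness[where f' = "\<lambda>\<kappa>. {v \<in> V. \<kappa> v = 1}"])
  have two: "\<kappa> v = 1 \<or> \<kappa> v = 2" if "\<kappa> \<in> ?T" "v \<in> V" for \<kappa> v
  proof (rule ccontr)
    assume "\<not> ?thesis"
    moreover have "(if \<kappa> v = 1 then a else if \<kappa> v = 2 then card V - a else 0)
        = card {w \<in> V. \<kappa> w = \<kappa> v}"
      using that(1) by blast
    ultimately have "card {w \<in> V. \<kappa> w = \<kappa> v} = 0"
      by simp
    then show False
      using fin that(2) by auto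
  qed
  show "\<forall>A \<in> ?S. {v \<in> V. ?f A v = 1} = A"
    by auto
  show "\<forall>\<kappa> \<in> ?T. ?f {v \<in> V. \<kappa> v = 1} = \<kappa>"
  proof
    fix \<kappa> assume \<kappa>: "\<kappa> \<in> ?T"
    then have ext: "\<kappa> \<in> extensional V"
      by (simp add: PiE_iff)
    show "?f {v \<in> V. \<kappa> v = 1} = \<kappa>"
      by (rule extensionalityI[OF restrict_extensional ext]) (use two[OF \<kappa>] in auto)
  qed
  show "?f ` ?S \<subseteq> ?T"
  proof
    fix \<kappa> assume "\<kappa> \<in> ?f ` ?S"
    then obtain A where A: "A \<subseteq> V" "card A = a" and \<kappa>: "\<kappa> = ?f A"
      by blast
    have "{v \<in> V. \<kappa> v = 1} = A" "{v \<in> V. \<kappa> v = 2} = V - A"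
      using A(1) by (auto simp: \<kappa>)
    moreover have "{v \<in> V. \<kappa> v = i} = {}" if "i \<noteq> 1" "i \<noteq> 2" for i
      using that by (auto simp: \<kappa>)
    ultimately have "(if i = 1 then a else if i = 2 then card V - a else 0)
        = card {v \<in> V. \<kappa> v = i}" for i
      using A fin by (simp add: card_Diff_subset finite_subset)
    moreover have "\<kappa> \<in> V \<rightarrow>\<^sub>E {1..N}"
      using \<open>2 \<le> N\<close> by (auto simp: \<kappa>)
    ultimately show "\<kappa> \<in> ?T"
      by blast
  qed
  show "(\<lambda>\<kappa>. {v \<in> V. \<kappa> v = 1}) ` ?T \<subseteq> ?S"
    by auto
qed

text \<open>If 1 and 2 lie on the same side of \<open>H\<close>, the preimage of the labels of
  \<open>U\<close> is everything or empty, whatever the class of color 1; hence all colorings count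
  or none does. If they lie on different sides, the preimage is that class or its complement, and
  the class must itself be a side.\<close>

lemma count_two_label_colorings:
  assumes "wf_digraph G" and fin: "finite (verts G)" and a: "a \<le> card (verts G)" "2 \<le> card (verts H)"
    and UV: "verts H = U \<union> V" "U \<inter> V = {}" "arcs_ends H = U \<times> V \<union> V \<times> U"
    and \<phi>: "\<phi> \<in> labelings H"
  shows "card {\<kappa> \<in> proper_colorings G H \<phi>.
      \<forall>i. (if i = 1 then a else if i = 2 then card (verts G) - a else 0) = card {v \<in> verts G. \<kappa> v = i}} =
    (if (1 \<in> \<phi> ` U) = (2 \<in> \<phi> ` U)
     then (card (verts G) choose a) * card {A \<in> sides G. card A = 0}
     else card {A \<in> sides G. card A = a})"
    (is "card ?C = ?R")
proof -
  let ?W = "verts G" and ?P = "\<phi> ` U"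
  let ?f = "\<lambda>A. \<lambda>v \<in> ?W. if v \<in> A then 1 else 2 :: nat"
  let ?T = "{\<kappa> \<in> ?W \<rightarrow>\<^sub>E {1..card (verts H)}.
    \<forall>i. (if i = 1 then a else if i = 2 then card ?W - a else 0) = card {v \<in> ?W. \<kappa> v = i}}"
  let ?D = "{A. A \<subseteq> ?W \<and> card A = a \<and> {v \<in> ?W. ?f A v \<in> ?P} \<in> sides G}"
  note bij = colorings_two_labels[OF fin a]
  \<comment> \<open>For the given class sizes, properness becomes a condition on the class
    \<open>A\<close> of color 1, so the count moves from colorings to sets.\<close>
  have "?C = {\<kappa> \<in> ?T. {v \<in> ?W. \<kappa> v \<in> ?P} \<in> sides G}"
    unfolding proper_colorings_complete_bipartite[OF assms(1) UV \<phi>] by blast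
  also have "\<dots> = ?f ` ?D"
    unfolding bij_betw_imp_surj_on[OF bij, symmetric] by blast
  finally have "card ?C = card ?D"
    using card_image[OF inj_on_subset[OF bij_betw_imp_inj_on[OF bij], of ?D]] by (simp only:) blast
  also have "\<dots> = ?R"
  proof (cases "1 \<in> ?P"; cases "2 \<in> ?P")
    \<comment> \<open>Finiteness of sides excludes infinite sets, whose \<open>card\<close> is 0 by
      convention. The count is thus 1 or 0 according to whether \<open>{}\<close> is a side.\<close>
    have zero: "{A \<in> sides G. card A = 0} = (if {} \<in> sides G then {{}} else {})"
      using finite_subset[OF sides_subset fin] by (auto simp: card_eq_0_iff)
    have choose: "card {A. A \<subseteq> ?W \<and> card A = a} = card ?W choose a"
      by (rule n_subsets[OF fin])
    {
      assume "1 \<in> ?P" "2 \<in> ?P"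
      then have "{v \<in> ?W. ?f A v \<in> ?P} = ?W" for A
        by auto
      then show ?thesis
        using \<open>1 \<in> ?P\<close> \<open>2 \<in> ?P\<close> Compl_in_sides_iff[OF assms(1), of "{}"] choose
        by (simp add: zero)
    next
      assume "1 \<notin> ?P" "2 \<notin> ?P"
      then have "{v \<in> ?W. ?f A v \<in> ?P} = {}" for A
        by auto
      then show ?thesis
        using \<open>1 \<notin> ?P\<close> \<open>2 \<notin> ?P\<close> choose by (simp add: zero)
    next
      assume P: "1 \<in> ?P" "2 \<notin> ?P"
      then have "{v \<in> ?W. ?f A v \<in> ?P} = A" if "A \<subseteq> ?W" for A
        using that by (auto split: if_splits)
      then have "{v \<in> ?W. ?f A v \<in> ?P} \<in> sides G \<longleftrightarrow> A \<in> sides G" if "A \<subseteq> ?W" for A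
        using that by simp
      then have "?D = {A \<in> sides G. card A = a}"
        using sides_subset[of _ G] by blast
      then show ?thesis
        using P by (simp only:) simp
    next
      assume P: "1 \<notin> ?P" "2 \<in> ?P"
      then have "{v \<in> ?W. ?f A v \<in> ?P} = ?W - A" if "A \<subseteq> ?W" for A
        using that by (auto split: if_splits)
      then have "{v \<in> ?W. ?f A v \<in> ?P} \<in> sides G \<longleftrightarrow> A \<in> sides G" if "A \<subseteq> ?W" for A
        using that Compl_in_sides_iff[OF assms(1) that] by simp
      then have "?D = {A \<in> sides G. card A = a}"
        using sides_subset[of _ G] by blast
      then show ?thesis
        using P by (simp only:) simp
    }
  qed
  finally show ?thesis .
qed

lemma finite_labelings: "finite (verts H) \<Longrightarrow> finite (labelings H)"
  unfolding labelings_def by (rule finite_subset[OF _ finite_PiE[of "verts H" "\<lambda>_. {1..card (verts H)}"]]) auto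

text \<open>The contribution of a labeling depends only on whether it puts 1 and 2 on the same side,
  so the sum over labelings collapses to the sizes of two classes.\<close>

lemma lookup_chromatic_polynomial_two_variables:
  assumes "graph G" "bipartite G" and a: "a \<le> card (verts G)" "2 \<le> card (verts H)"
    and UV: "verts H = U \<union> V" "U \<inter> V = {}" "arcs_ends H = U \<times> V \<union> V \<times> U"
  shows "lookup (chromatic_polynomial G H)
      (Poly_Mapping.single 1 a + Poly_Mapping.single 2 (card (verts G) - a)) =
    int (card {\<phi> \<in> labelings H. (1 \<in> \<phi> ` U) = (2 \<in> \<phi> ` U)} * (card (verts G) choose a) *
        count (part_size_multiset G) 0 +
      card {\<phi> \<in> labelings H. (1 \<in> \<phi> ` U) \<noteq> (2 \<in> \<phi> ` U)} * count (part_size_multiset G) a)"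
proof -
  interpret graph G by fact
  let ?S = "part_size_multiset G" and ?k = "card (verts G)"
  have cnt: "count ?S j = card {A \<in> sides G. card A = j}" for j
    unfolding part_size_multiset_eq_card_sides[OF assms(2)]
    by (rule count_image_card_mset_set[OF finite_sides[OF finite_verts]])
  have finH: "finite (labelings H)"
    using a(2) by (intro finite_labelings) (simp add: card_ge_0_finite)
  have finC: "finite (proper_colorings G H \<phi>)" for \<phi>
    unfolding proper_colorings_def
    by (rule finite_subset[OF _ finite_PiE[of "verts G" "\<lambda>_. {1..card (verts H)}"]]) auto
  have "lookup (chromatic_polynomial G H)
      (Poly_Mapping.single 1 a + Poly_Mapping.single 2 (?k - a)) =
    (\<Sum>\<phi> \<in> labelings H. int (card {\<kappa> \<in> proper_colorings G H \<phi>.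
      \<forall>i. (if i = 1 then a else if i = 2 then ?k - a else 0) = card {v \<in> verts G. \<kappa> v = i}}))"
    unfolding lookup_chromatic_polynomial[OF finite_verts] lookup_two_variables
    using finC by (simp add: sum.If_cases Int_def)
  also have "\<dots> = (\<Sum>\<phi> \<in> labelings H. int (if (1 \<in> \<phi> ` U) = (2 \<in> \<phi> ` U)
      then (?k choose a) * count ?S 0 else count ?S a))"
    using count_two_label_colorings[OF wf_digraph_axioms finite_verts a UV]
    by (intro sum.cong) (simp_all only: cnt)
  also have "\<dots> = int (card {\<phi> \<in> labelings H. (1 \<in> \<phi> ` U) = (2 \<in> \<phi> ` U)} * ((?k choose a) * count ?S 0) +
      card {\<phi> \<in> labelings H. (1 \<in> \<phi> ` U) \<noteq> (2 \<in> \<phi> ` U)} * count ?S a)"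
    unfolding of_nat_sum[symmetric] using finH by (subst sum.If_cases) (auto simp: Int_def)
  finally show ?thesis
    by (simp only: mult.assoc)
qed

text \<open>Provides the positivity of \<open>d\<close>: one vertex of each side receives the labels
  1 and 2, and the other vertices are labeled arbitrarily.\<close>

lemma ex_labeling_separating:
  assumes "finite (verts H)" "verts H = U \<union> V" "U \<inter> V = {}" "U \<noteq> {}" "V \<noteq> {}"
  shows "\<exists>\<phi> \<in> labelings H. 1 \<in> \<phi> ` U \<and> 2 \<notin> \<phi> ` U"
proof -
  obtain u v where uv: "u \<in> U" "v \<in> V"
    using assms by blast
  then have ne: "u \<noteq> v" "u \<in> verts H" "v \<in> verts H"
    using assms by auto
  let ?R = "verts H - {u, v}"
  have "card {u, v} \<le> card (verts H)"
    using ne assms(1) by (intro card_mono) auto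
  then have two: "2 \<le> card (verts H)"
    using ne(1) by simp
  \<comment> \<open>With 1 and 2 reserved, the remaining labels start at 3; both sets are empty when
    \<open>H\<close> is a single edge.\<close>
  have "card ?R = card {3..card (verts H)}"
    using ne assms(1) by (simp add: card_Diff_subset)
  then obtain h where h: "bij_betw h ?R {3..card (verts H)}"
    using assms(1) finite_same_card_bij[of ?R "{3..card (verts H)}"] by blast
  define g where "g x = (if x = u then 1 else if x = v then 2 else h x)" for x
  have "bij_betw g ?R {3..card (verts H)}"
    using h by (rule bij_betw_cong[THEN iffD1, rotated]) (simp add: g_def)
  moreover have "bij_betw g {u, v} {1, 2}"
    using ne(1) by (auto simp: bij_betw_def g_def)
  ultimately have "bij_betw g (?R \<union> {u, v}) ({3..card (verts H)} \<union> {1, 2})"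
    by (rule bij_betw_combine) auto
  moreover have "?R \<union> {u, v} = verts H" "{3..card (verts H)} \<union> {1, 2} = {1..card (verts H)}"
    using ne two by auto
  ultimately have bij: "bij_betw g (verts H) {1..card (verts H)}"
    by simp
  define \<phi> where "\<phi> = restrict g (verts H)"
  have \<phi>: "bij_betw \<phi> (verts H) {1..card (verts H)}"
    using bij unfolding \<phi>_def by (simp cong: bij_betw_cong)
  then have "\<phi> \<in> labelings H"
    unfolding labelings_def by (auto simp: \<phi>_def dest: bij_betwE)
  moreover have "\<phi> u = 1" "\<phi> v = 2"
    using ne by (auto simp: \<phi>_def g_def)
  moreover have "2 \<notin> \<phi> ` U"
  proof
    assume "2 \<in> \<phi> ` U"
    then obtain w where "w \<in> U" "\<phi> w = \<phi> v"
      using \<open>\<phi> v = 2\<close> by auto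
    then have "w = v"
      using \<phi> ne(3) assms(2) by (auto simp: bij_betw_def dest: inj_onD)
    then show False
      using \<open>w \<in> U\<close> uv assms(3) by blast
  qed
  ultimately show ?thesis
    using uv(1) by (metis image_eqI)
qed

section \<open>Recovering the multiplicities of \<open>S(G)\<close> from the coefficients\<close>

theorem proposition5p9:
  fixes G\<^sub>1 :: "('a, 'b) pre_digraph" and G\<^sub>2 :: "('c, 'd) pre_digraph"
    and H :: "('e, 'f) pre_digraph" and k m n :: nat
  assumes "graph G\<^sub>1" and "verts G\<^sub>1 \<noteq> {}" and "bipartite G\<^sub>1" and "card (verts G\<^sub>1) = k"
    and "graph G\<^sub>2" and "verts G\<^sub>2 \<noteq> {}" and "bipartite G\<^sub>2" and "card (verts G\<^sub>2) = k"
    and "m \<ge> 1" and "n \<ge> 1" and "complete_bipartite_digraph m n H"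
  shows "chromatic_symmetric_function G\<^sub>1 H = chromatic_symmetric_function G\<^sub>2 H
    \<longleftrightarrow> part_size_multiset G\<^sub>1 = part_size_multiset G\<^sub>2"
proof
  obtain U V where UV: "verts H = U \<union> V" "U \<inter> V = {}" "arcs_ends H = U \<times> V \<union> V \<times> U"
    and card: "card U = m" "card V = n" and "graph H"
    using assms(11) by (auto simp: complete_bipartite_digraph_def)
  interpret G1: graph G\<^sub>1 by fact
  interpret G2: graph G\<^sub>2 by fact
  interpret H: graph H by fact
  show "chromatic_symmetric_function G\<^sub>1 H = chromatic_symmetric_function G\<^sub>2 H"
    if "part_size_multiset G\<^sub>1 = part_size_multiset G\<^sub>2"
    using chromatic_polynomial_complete_bipartite[OF assms(1,3) UV]
      chromatic_polynomial_complete_bipartite[OF assms(5,7) UV] that assms(4,8)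
    by (intro chromatic_symmetric_function_cong) simp_all
  assume eq: "chromatic_symmetric_function G\<^sub>1 H = chromatic_symmetric_function G\<^sub>2 H"
  have ne: "U \<noteq> {}" "V \<noteq> {}" and "card (verts H) = m + n"
    using card assms(9,10) UV H.finite_verts by (auto simp: card_Un_disjoint)
  then have two: "2 \<le> card (verts H)"
    using assms(9,10) by simp
  define d where "d = card {\<phi> \<in> labelings H. (1 \<in> \<phi> ` U) \<noteq> (2 \<in> \<phi> ` U)}"
  define s where "s = card {\<phi> \<in> labelings H. (1 \<in> \<phi> ` U) = (2 \<in> \<phi> ` U)}"
  have "d > 0"
    using ex_labeling_separating[OF H.finite_verts UV(1,2) ne] finite_labelings[OF H.finite_verts]
    unfolding d_def by (auto simp: card_gt_0_iff)
  have coeff: "s * (k choose a) * count (part_size_multiset G\<^sub>1) 0 + d * count (part_size_multiset G\<^sub>1) a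
      = s * (k choose a) * count (part_size_multiset G\<^sub>2) 0 + d * count (part_size_multiset G\<^sub>2) a"
    if a: "a \<le> k" for a
  proof -
    let ?\<alpha> = "Poly_Mapping.single 1 a + Poly_Mapping.single 2 (k - a) :: exponents"
    \<comment> \<open>Only an inclusion in general: for \<open>a = 0\<close> or \<open>a = k\<close>
      an exponent vanishes and its index leaves the support.\<close>
    have "keys ?\<alpha> \<subseteq> {1..card (verts H)}"
      using two lookup_two_variables[of a "k - a"] by (auto simp: in_keys_iff split: if_splits)
    then have "lookup (chromatic_polynomial G\<^sub>1 H) ?\<alpha> = lookup (chromatic_polynomial G\<^sub>2 H) ?\<alpha>"
      using eq chromatic_symmetric_function_eq_lookup[OF G1.finite_verts]
        chromatic_symmetric_function_eq_lookup[OF G2.finite_verts] by metis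
    then show ?thesis
      using lookup_chromatic_polynomial_two_variables[OF assms(1,3) _ two UV, of a]
        lookup_chromatic_polynomial_two_variables[OF assms(5,7) _ two UV, of a] a assms(4,8)
      unfolding s_def d_def by (simp only: of_nat_eq_iff)
  qed
  \<comment> \<open>At \<open>a = 0\<close> the binomial coefficient is 1 and both terms involve the
    multiplicity of 0, which can be cancelled free since \<open>s + d > 0\<close>. Knowing it
    removes the first term from every other equation.\<close>
  have "(s + d) * count (part_size_multiset G\<^sub>1) 0 = (s + d) * count (part_size_multiset G\<^sub>2) 0"
    using coeff[of 0] by (simp add: add_mult_distrib)
  then have zero: "count (part_size_multiset G\<^sub>1) 0 = count (part_size_multiset G\<^sub>2) 0"
    using \<open>d > 0\<close> by simp
  show "part_size_multiset G\<^sub>1 = part_size_multiset G\<^sub>2"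
  proof (rule multiset_eqI)
    fix a
    show "count (part_size_multiset G\<^sub>1) a = count (part_size_multiset G\<^sub>2) a"
    proof (cases "a \<le> k")
      case True
      then show ?thesis
        using coeff zero \<open>d > 0\<close> by simp
    next
      \<comment> \<open>No coefficient reaches these values, but the elements of \<open>S(G)\<close>
        are sizes of vertex sets, so both multiplicities are 0.\<close>
      case False
      then show ?thesis
        using G1.part_size_multiset_le[OF assms(3), of a] G2.part_size_multiset_le[OF assms(7), of a]
          assms(4,8) by (metis count_inI)
    qed
  qed
qed

end
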